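(* Let $k$ be a field and let $X$ be a finite set with $|X|=n$. Then the Hilbert series of the free dendriform algebra $DD(X)$ over $k$ is $$\mathcal{H}(DD(X),t)=\sum_{m=1}^{\infty}\frac{1\cdot3\cdots(2m-1)\cdot2^m}{(m+1)!}\,n^mt^m=\sum_{m=1}^{\infty}\frac{(2m)!\,n^m\,t^m}{(m+1)!\,m!}.$$ Therefore $\dim_k(DD_m)=\dfrac{(2m)!\,n^m}{(m+1)!\,m!}$ for all $m\ge1$.
   Context: A dendriform algebra over $k$ is a $k$-vector space with bilinear operations $\prec,\succ$ satisfying, for all $x,y,z$: $(x\succ y)\prec z=x\succ(y\prec z)$; $(x\prec y)\prec z=x\prec(y\prec z)+x\prec(y\succ z)$; $x\succ(y\succ z)=(x\succ y)\succ z+(x\prec y)\succ z$. $DD(X)$ is the free dendriform algebra on $X$. Normal $DD$-words over $X$ are the formal expressions defined recursively as: $x$; $x\prec v$; $x\succ v$; $(x\succ u_1)\succ u_2$; where $x\in X$ and $v,u_1,u_2$ are normal $DD$-words. The degree of a word is the number of occurrences of elements of $X$ in it. $DD_m$ is the subspace of $DD(X)$ spanned by all normal $DD$-words of degree $m$ (evaluated in $DD(X)$). This makes $DD(X)=\bigoplus_{m\ge1}DD_m$ a finitely graded dendriform algebra (each $DD_m$ is finite-dimensional and $\delta(DD_i,DD_j)\subseteq DD_{i+j}$ for $\delta\in\{\prec,\succ\}$, $i,j\ge1$). Its Hilbert series is the formal power series $\mathcal{H}(DD(X),t)=\sum_{m=1}^{\infty}\dim_k(DD_m)\,t^m$. 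*)

theory Defs
  imports Complex_Main "HOL-Computational_Algebra.Formal_Power_Series"
begin

section \<open>Dendriform algebras\<close>

locale dendriform_algebra = vector_space scale
  for scale :: "'k::field \<Rightarrow> 'a::ab_group_add \<Rightarrow> 'a" (infixr "*s" 75) +
  fixes prec :: "'a \<Rightarrow> 'a \<Rightarrow> 'a" (infix "\<prec>" 70)
    and succ :: "'a \<Rightarrow> 'a \<Rightarrow> 'a" (infix "\<succ>" 70)
  assumes prec_add_left: "(x + y) \<prec> z = x \<prec> z + y \<prec> z"
    and prec_add_right: "x \<prec> (y + z) = x \<prec> y + x \<prec> z"
    and prec_scale_left: "(c *s x) \<prec> y = c *s (x \<prec> y)"
    and prec_scale_right: "x \<prec> (c *s y) = c *s (x \<prec> y)"
    and succ_add_left: "(x + y) \<succ> z = x \<succ> z + y \<succ> z"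
    and succ_add_right: "x \<succ> (y + z) = x \<succ> y + x \<succ> z"
    and succ_scale_left: "(c *s x) \<succ> y = c *s (x \<succ> y)"
    and succ_scale_right: "x \<succ> (c *s y) = c *s (x \<succ> y)"
    and succ_prec: "(x \<succ> y) \<prec> z = x \<succ> (y \<prec> z)"
    and prec_prec: "(x \<prec> y) \<prec> z = x \<prec> (y \<prec> z) + x \<prec> (y \<succ> z)"
    and succ_succ: "x \<succ> (y \<succ> z) = (x \<succ> y) \<succ> z + (x \<prec> y) \<succ> z"
begin

definition subalgebra :: "'a set \<Rightarrow> bool" where
  "subalgebra S \<longleftrightarrow> subspace S \<and> (\<forall>a\<in>S. \<forall>b\<in>S. a \<prec> b \<in> S \<and> a \<succ> b \<in> S)"

end

definition dendriform_hom_on ::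
  "'a set \<Rightarrow> ('k::field \<Rightarrow> 'a::ab_group_add \<Rightarrow> 'a) \<Rightarrow> ('a \<Rightarrow> 'a \<Rightarrow> 'a) \<Rightarrow> ('a \<Rightarrow> 'a \<Rightarrow> 'a) \<Rightarrow>
   ('k \<Rightarrow> 'b::ab_group_add \<Rightarrow> 'b) \<Rightarrow> ('b \<Rightarrow> 'b \<Rightarrow> 'b) \<Rightarrow> ('b \<Rightarrow> 'b \<Rightarrow> 'b) \<Rightarrow> ('a \<Rightarrow> 'b) \<Rightarrow> bool" where
  "dendriform_hom_on S sA pA sucA sB pB sucB \<phi> \<longleftrightarrow>
     (\<forall>a\<in>S. \<forall>b\<in>S. \<phi> (a + b) = \<phi> a + \<phi> b \<and> \<phi> (pA a b) = pB (\<phi> a) (\<phi> b) \<and>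
        \<phi> (sucA a b) = sucB (\<phi> a) (\<phi> b)) \<and>
     (\<forall>c. \<forall>a\<in>S. \<phi> (sA c a) = sB c (\<phi> a))"


section \<open>The free dendriform algebra\<close>

text \<open>
  The free dendriform algebra on all of \<open>'x\<close> is the term algebra of the signature of dendriform
  algebras over \<open>'k\<close>, modulo the congruence generated by their defining equations. For a set
  \<open>X\<close> of elements of \<open>'x\<close>, \<open>DD(X)\<close> is the subalgebra generated by \<open>X\<close>; its freeness is
  \<open>DD_universal\<close> below.
\<close>

datatype ('x, 'k) dd_expr =
    EGen 'x
  | EZero
  | EAdd "('x, 'k) dd_expr" "('x, 'k) dd_expr"
  | EMinus "('x, 'k) dd_expr"
  | EScale 'k "('x, 'k) dd_expr"
  | EPrec "('x, 'k) dd_expr" "('x, 'k) dd_expr"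
  | ESucc "('x, 'k) dd_expr" "('x, 'k) dd_expr"

inductive dd_eq :: "('x, 'k::field) dd_expr \<Rightarrow> ('x, 'k) dd_expr \<Rightarrow> bool" where
  refl: "dd_eq a a"
| sym: "dd_eq a b \<Longrightarrow> dd_eq b a"
| trans: "dd_eq a b \<Longrightarrow> dd_eq b c \<Longrightarrow> dd_eq a c"
| cong_add: "dd_eq a a' \<Longrightarrow> dd_eq b b' \<Longrightarrow> dd_eq (EAdd a b) (EAdd a' b')"
| cong_minus: "dd_eq a a' \<Longrightarrow> dd_eq (EMinus a) (EMinus a')"
| cong_scale: "dd_eq a a' \<Longrightarrow> dd_eq (EScale r a) (EScale r a')"
| cong_prec: "dd_eq a a' \<Longrightarrow> dd_eq b b' \<Longrightarrow> dd_eq (EPrec a b) (EPrec a' b')"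
| cong_succ: "dd_eq a a' \<Longrightarrow> dd_eq b b' \<Longrightarrow> dd_eq (ESucc a b) (ESucc a' b')"
| add_assoc: "dd_eq (EAdd (EAdd a b) c) (EAdd a (EAdd b c))"
| add_comm: "dd_eq (EAdd a b) (EAdd b a)"
| add_zero: "dd_eq (EAdd EZero a) a"
| add_minus: "dd_eq (EAdd (EMinus a) a) EZero"
| scale_add_right: "dd_eq (EScale r (EAdd a b)) (EAdd (EScale r a) (EScale r b))"
| scale_add_left: "dd_eq (EScale (r + s) a) (EAdd (EScale r a) (EScale s a))"
| scale_scale: "dd_eq (EScale r (EScale s a)) (EScale (r * s) a)"
| scale_one: "dd_eq (EScale 1 a) a"
| prec_add_left: "dd_eq (EPrec (EAdd a b) c) (EAdd (EPrec a c) (EPrec b c))"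
| prec_add_right: "dd_eq (EPrec a (EAdd b c)) (EAdd (EPrec a b) (EPrec a c))"
| prec_scale_left: "dd_eq (EPrec (EScale r a) b) (EScale r (EPrec a b))"
| prec_scale_right: "dd_eq (EPrec a (EScale r b)) (EScale r (EPrec a b))"
| succ_add_left: "dd_eq (ESucc (EAdd a b) c) (EAdd (ESucc a c) (ESucc b c))"
| succ_add_right: "dd_eq (ESucc a (EAdd b c)) (EAdd (ESucc a b) (ESucc a c))"
| succ_scale_left: "dd_eq (ESucc (EScale r a) b) (EScale r (ESucc a b))"
| succ_scale_right: "dd_eq (ESucc a (EScale r b)) (EScale r (ESucc a b))"
| succ_prec: "dd_eq (EPrec (ESucc a b) c) (ESucc a (EPrec b c))"
| prec_prec: "dd_eq (EPrec (EPrec a b) c) (EAdd (EPrec a (EPrec b c)) (EPrec a (ESucc b c)))"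
| succ_succ: "dd_eq (ESucc a (ESucc b c)) (EAdd (ESucc (ESucc a b) c) (ESucc (EPrec a b) c))"

quotient_type (overloaded) ('x, 'k) dd = "('x, 'k::field) dd_expr" / dd_eq
  by (intro equivpI reflpI sympI transpI) (blast intro: dd_eq.refl dd_eq.sym dd_eq.trans)+

instantiation dd :: (type, field) ab_group_add
begin

lift_definition zero_dd :: "('a, 'b) dd" is EZero .
lift_definition plus_dd :: "('a, 'b) dd \<Rightarrow> ('a, 'b) dd \<Rightarrow> ('a, 'b) dd" is EAdd
  by (rule dd_eq.cong_add)
lift_definition uminus_dd :: "('a, 'b) dd \<Rightarrow> ('a, 'b) dd" is EMinus
  by (rule dd_eq.cong_minus)
definition minus_dd :: "('a, 'b) dd \<Rightarrow> ('a, 'b) dd \<Rightarrow> ('a, 'b) dd" where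
  "minus_dd a b = a + - b"

instance
proof
  fix a b c :: "('a, 'b) dd"
  show "a + b + c = a + (b + c)" by transfer (rule dd_eq.add_assoc)
  show "a + b = b + a" by transfer (rule dd_eq.add_comm)
  show "0 + a = a" by transfer (rule dd_eq.add_zero)
  show "- a + a = 0" by transfer (rule dd_eq.add_minus)
  show "a - b = a + - b" by (rule minus_dd_def)
qed

end

lift_definition dd_gen :: "'x \<Rightarrow> ('x, 'k::field) dd" is EGen .

lift_definition dd_scale :: "'k::field \<Rightarrow> ('x, 'k) dd \<Rightarrow> ('x, 'k) dd" is EScale
  by (rule dd_eq.cong_scale)

lift_definition dd_prec :: "('x, 'k::field) dd \<Rightarrow> ('x, 'k) dd \<Rightarrow> ('x, 'k) dd" is EPrec
  by (rule dd_eq.cong_prec)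

lift_definition dd_succ :: "('x, 'k::field) dd \<Rightarrow> ('x, 'k) dd \<Rightarrow> ('x, 'k) dd" is ESucc
  by (rule dd_eq.cong_succ)

global_interpretation dd: dendriform_algebra dd_scale dd_prec dd_succ
  by unfold_locales (transfer, (rule dd_eq.intros(9-)))+

definition DD :: "'x set \<Rightarrow> ('x, 'k::field) dd set" where
  "DD X = dd.subalgebra hull (dd_gen ` X)"

lemma subalgebra_DD: "dd.subalgebra (DD X)"
  unfolding DD_def
  by (rule hull_in) (auto simp: dd.subalgebra_def dd.subspace_def)

lemma dd_gen_in_DD: "x \<in> X \<Longrightarrow> dd_gen x \<in> DD X"
  unfolding DD_def by (rule subsetD[OF hull_subset imageI])

lemma DD_minimal: "dd_gen ` X \<subseteq> S \<Longrightarrow> dd.subalgebra S \<Longrightarrow> DD X \<subseteq> S"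
  unfolding DD_def by (rule hull_minimal)

lemma DD_closed:
  fixes a b :: "('x, 'k::field) dd"
  shows "dd.subspace (DD X :: ('x, 'k) dd set)" and "(0 :: ('x, 'k) dd) \<in> DD X"
    and "a \<in> DD X \<Longrightarrow> b \<in> DD X \<Longrightarrow> dd_prec a b \<in> DD X"
    and "a \<in> DD X \<Longrightarrow> b \<in> DD X \<Longrightarrow> dd_succ a b \<in> DD X"
proof -
  have "dd.subalgebra (DD X :: ('x, 'k) dd set)" by (rule subalgebra_DD)
  then show "dd.subspace (DD X :: ('x, 'k) dd set)" "(0 :: ('x, 'k) dd) \<in> DD X"
    "a \<in> DD X \<Longrightarrow> b \<in> DD X \<Longrightarrow> dd_prec a b \<in> DD X"
    "a \<in> DD X \<Longrightarrow> b \<in> DD X \<Longrightarrow> dd_succ a b \<in> DD X"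
    by (simp_all add: dd.subalgebra_def dd.subspace_0)
qed

lemma DD_induct [consumes 1, case_names gen zero add scale prec succ]:
  fixes a :: "('x, 'k::field) dd"
  assumes "a \<in> DD X" "\<And>x. x \<in> X \<Longrightarrow> P (dd_gen x)" "P 0"
    "\<And>a b. a \<in> DD X \<Longrightarrow> b \<in> DD X \<Longrightarrow> P a \<Longrightarrow> P b \<Longrightarrow> P (a + b)"
    "\<And>c a. a \<in> DD X \<Longrightarrow> P a \<Longrightarrow> P (dd_scale c a)"
    "\<And>a b. a \<in> DD X \<Longrightarrow> b \<in> DD X \<Longrightarrow> P a \<Longrightarrow> P b \<Longrightarrow> P (dd_prec a b)"
    "\<And>a b. a \<in> DD X \<Longrightarrow> b \<in> DD X \<Longrightarrow> P a \<Longrightarrow> P b \<Longrightarrow> P (dd_succ a b)"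
  shows "P a"
proof -
  have sub: "dd.subspace (DD X :: ('x, 'k) dd set)"
    by (rule DD_closed)
  have "dd.subspace {a \<in> DD X. P a}"
  proof (rule dd.subspaceI; clarify)
    show "0 \<in> DD X \<and> P 0"
      by (intro conjI DD_closed(2) assms(3))
    show "a + b \<in> DD X \<and> P (a + b)" if "a \<in> DD X" "P a" "b \<in> DD X" "P b" for a b
      using that by (intro conjI dd.subspace_add[OF sub] assms(4))
    show "dd_scale c a \<in> DD X \<and> P (dd_scale c a)" if "a \<in> DD X" "P a" for c a
      using that by (intro conjI dd.subspace_scale[OF sub] assms(5))
  qed
  then have "dd.subalgebra {a \<in> DD X. P a}"
    unfolding dd.subalgebra_def mem_Collect_eq
    by (intro conjI ballI) (auto intro: DD_closed(3,4) assms(6,7))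
  moreover have "dd_gen ` X \<subseteq> {a \<in> DD X. P a}"
    by (intro image_subsetI CollectI conjI dd_gen_in_DD assms(2))
  ultimately have "DD X \<subseteq> {a \<in> DD X. P a}"
    by (intro DD_minimal)
  with assms(1) show ?thesis by blast
qed

primrec expr_eval ::
  "('k::field \<Rightarrow> 'a::ab_group_add \<Rightarrow> 'a) \<Rightarrow> ('a \<Rightarrow> 'a \<Rightarrow> 'a) \<Rightarrow> ('a \<Rightarrow> 'a \<Rightarrow> 'a) \<Rightarrow>
   ('x \<Rightarrow> 'a) \<Rightarrow> ('x, 'k) dd_expr \<Rightarrow> 'a" where
  "expr_eval s p q f (EGen x) = f x"
| "expr_eval s p q f EZero = 0"
| "expr_eval s p q f (EAdd a b) = expr_eval s p q f a + expr_eval s p q f b"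
| "expr_eval s p q f (EMinus a) = - expr_eval s p q f a"
| "expr_eval s p q f (EScale r a) = s r (expr_eval s p q f a)"
| "expr_eval s p q f (EPrec a b) = p (expr_eval s p q f a) (expr_eval s p q f b)"
| "expr_eval s p q f (ESucc a b) = q (expr_eval s p q f a) (expr_eval s p q f b)"

lemma expr_eval_respects:
  assumes "dendriform_algebra s p q" "dd_eq a b"
  shows "expr_eval s p q f a = expr_eval s p q f b"
proof -
  interpret dendriform_algebra s p q by fact
  show ?thesis
    using assms(2)
    by induction
      (simp_all add: prec_add_left prec_add_right prec_scale_left prec_scale_right
        succ_add_left succ_add_right succ_scale_left succ_scale_right
        succ_prec prec_prec succ_succ scale_left_distrib scale_right_distrib add_ac)
qed

theorem DD_universal:
  fixes s :: "'k::field \<Rightarrow> 'a::ab_group_add \<Rightarrow> 'a" and f :: "'x \<Rightarrow> 'a"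
  assumes A: "dendriform_algebra s p q"
  shows "\<exists>\<phi>. dendriform_hom_on (DD X) dd_scale dd_prec dd_succ s p q \<phi> \<and>
           (\<forall>x\<in>X. \<phi> (dd_gen x) = f x)" (is ?ex)
    and "\<And>\<phi> \<psi> a. dendriform_hom_on (DD X) dd_scale dd_prec dd_succ s p q \<phi> \<Longrightarrow>
           dendriform_hom_on (DD X) dd_scale dd_prec dd_succ s p q \<psi> \<Longrightarrow>
           (\<And>x. x \<in> X \<Longrightarrow> \<phi> (dd_gen x) = \<psi> (dd_gen x)) \<Longrightarrow>
           a \<in> DD X \<Longrightarrow> \<phi> a = \<psi> a"
proof -
  define \<phi> where "\<phi> = (\<lambda>a::('x,'k) dd. expr_eval s p q f (rep_dd a))"
  have \<phi>: "\<phi> (abs_dd e) = expr_eval s p q f e" for e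
    unfolding \<phi>_def
    by (rule expr_eval_respects[OF A Quotient3_rep_abs[OF Quotient3_dd dd_eq.refl]])
  have "dendriform_hom_on (DD X) dd_scale dd_prec dd_succ s p q \<phi>"
    unfolding dendriform_hom_on_def
  proof (intro conjI ballI allI)
    fix a b :: "('x,'k) dd" and c
    obtain u v where "a = abs_dd u" "b = abs_dd v"
      using Quotient3_abs_rep[OF Quotient3_dd] by metis
    then show "\<phi> (a + b) = \<phi> a + \<phi> b" "\<phi> (dd_prec a b) = p (\<phi> a) (\<phi> b)"
      "\<phi> (dd_succ a b) = q (\<phi> a) (\<phi> b)" "\<phi> (dd_scale c a) = s c (\<phi> a)"
      by (simp_all add: \<phi> plus_dd.abs_eq dd_prec.abs_eq dd_succ.abs_eq dd_scale.abs_eq)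
  qed
  moreover have "\<phi> (dd_gen x) = f x" for x
    by (simp add: \<phi> dd_gen.abs_eq)
  ultimately show ?ex by blast
next
  fix \<phi> \<psi> :: "('x,'k) dd \<Rightarrow> 'a" and a :: "('x,'k) dd"
  assume h: "dendriform_hom_on (DD X) dd_scale dd_prec dd_succ s p q \<phi>"
     "dendriform_hom_on (DD X) dd_scale dd_prec dd_succ s p q \<psi>"
    and g: "\<And>x. x \<in> X \<Longrightarrow> \<phi> (dd_gen x) = \<psi> (dd_gen x)" and a: "a \<in> DD X"
  interpret dendriform_algebra s p q by fact
  have 0: "(0 :: ('x,'k) dd) \<in> DD X"
    by (rule DD_closed)
  show "\<phi> a = \<psi> a"
    using a
  proof (induction a rule: DD_induct)
    case zero
    have "\<chi> 0 = 0" if "dendriform_hom_on (DD X) dd_scale dd_prec dd_succ s p q \<chi>"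
      for \<chi> :: "('x,'k) dd \<Rightarrow> 'a"
    proof -
      have "\<chi> (dd_scale 0 0) = s 0 (\<chi> 0)"
        using that 0 unfolding dendriform_hom_on_def by blast
      then show ?thesis by simp
    qed
    from this[OF h(1)] this[OF h(2)] show ?case by simp
  qed (use h g in \<open>simp_all add: dendriform_hom_on_def\<close>)
qed


section \<open>Normal words and the Hilbert series\<close>

datatype 'x dd_word = Gen 'x | Prec "'x dd_word" "'x dd_word" | Succ "'x dd_word" "'x dd_word"

inductive_set normal_words :: "'x set \<Rightarrow> 'x dd_word set" for X where
  "x \<in> X \<Longrightarrow> Gen x \<in> normal_words X"
| "x \<in> X \<Longrightarrow> v \<in> normal_words X \<Longrightarrow> Prec (Gen x) v \<in> normal_words X"
| "x \<in> X \<Longrightarrow> v \<in> normal_words X \<Longrightarrow> Succ (Gen x) v \<in> normal_words X"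
| "x \<in> X \<Longrightarrow> u1 \<in> normal_words X \<Longrightarrow> u2 \<in> normal_words X \<Longrightarrow>
     Succ (Succ (Gen x) u1) u2 \<in> normal_words X"

primrec word_degree :: "'x dd_word \<Rightarrow> nat" where
  "word_degree (Gen x) = 1"
| "word_degree (Prec u v) = word_degree u + word_degree v"
| "word_degree (Succ u v) = word_degree u + word_degree v"

primrec word_eval :: "'x dd_word \<Rightarrow> ('x, 'k::field) dd" where
  "word_eval (Gen x) = dd_gen x"
| "word_eval (Prec u v) = dd_prec (word_eval u) (word_eval v)"
| "word_eval (Succ u v) = dd_succ (word_eval u) (word_eval v)"

definition DD_component :: "'x set \<Rightarrow> nat \<Rightarrow> ('x, 'k::field) dd set" where
  "DD_component X m = dd.span (word_eval ` {w \<in> normal_words X. word_degree w = m})"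

lemma DD_component_subset: "(DD_component X m :: ('x, 'k::field) dd set) \<subseteq> DD X"
proof -
  have "(word_eval w :: ('x, 'k) dd) \<in> DD X" if "w \<in> normal_words X" for w
    using that by induction (simp_all add: dd_gen_in_DD DD_closed)
  then show ?thesis
    unfolding DD_component_def
    by (intro dd.span_minimal) (auto intro: DD_closed)
qed

text \<open>
  The Hilbert series of a space graded in positive degrees depends on the family \<open>V\<close> of its
  homogeneous components only. There is no component of degree zero.
\<close>

definition (in vector_space) hilbert_series :: "(nat \<Rightarrow> 'b set) \<Rightarrow> rat fps" where
  "hilbert_series V = Abs_fps (\<lambda>m. if m = 0 then 0 else of_nat (dim (V m)))"

end

(*
Rewriting with the three axioms shows that the normal words span a family of subspaces closed
under both operations, and normal words of degree m are indexed by planar binary trees with m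
inner nodes labelled in X, so dim DD_m is at most the number of these trees.

For the lower bound, consider functions on words over X \<times> nat and restrict the concatenation
product to the splittings u v of a word in which the largest label occurs strictly to the left
(for \<prec>) or weakly to the right (for \<succ>). This is a dendriform algebra, and the tree
monomials (l \<succ> x) \<prec> r, mapped to it by x \<mapsto> sum of all letters (x, n), are dual to the words
obtained by reading a tree in order with every node labelled by its height. Hence they are linearly
independent in DD(X), and dim DD_m is the number of trees.

The generating function D of the Catalan numbers satisfies D = 1 + t D^2: by the recursion for
(2m)! / ((m+1)! m!), E = 1 - 2 t D solves (1 - 4t) E' = -2 E, so E^2 - (1 - 4t) solves
(1 - 4t) F' = -4 F with F(0) = 0 and vanishes.
*)

theory Submission
  imports Defs "HOL-Library.Function_Algebras" "HOL-Library.Tree"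
begin

section \<open>Normal words span\<close>

lemma normal_word_in_component:
  "w \<in> normal_words X \<Longrightarrow>
    (word_eval w :: ('x, 'k::field) dd) \<in> DD_component X (word_degree w)"
  unfolding DD_component_def by (rule dd.span_base) auto

lemma subspace_DD_component: "dd.subspace (DD_component X m :: ('x, 'k::field) dd set)"
  unfolding DD_component_def by (rule dd.subspace_span)

lemma DD_component_induct [consumes 1, case_names word zero add scale]:
  fixes a :: "('x, 'k::field) dd"
  assumes "a \<in> DD_component X m"
    and "\<And>w. w \<in> normal_words X \<Longrightarrow> word_degree w = m \<Longrightarrow> P (word_eval w)"
    and "P 0" "\<And>a b. P a \<Longrightarrow> P b \<Longrightarrow> P (a + b)" "\<And>c a. P a \<Longrightarrow> P (dd_scale c a)"
  shows "P a"
proof -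
  have "a \<in> dd.span (word_eval ` {w \<in> normal_words X. word_degree w = m})"
    using assms(1) by (simp add: DD_component_def)
  moreover have "dd.subspace {a. P a}"
    by (rule dd.subspaceI) (use assms(3-5) in auto)
  ultimately show ?thesis
    using dd.span_induct[of a _ P] assms(2) by blast
qed

lemmas component_closed =
  dd.subspace_0[OF subspace_DD_component] dd.subspace_add[OF subspace_DD_component]
  dd.subspace_diff[OF subspace_DD_component] dd.subspace_scale[OF subspace_DD_component]

lemma dd_zero [simp]:
  "dd_prec 0 a = 0" "dd_prec a 0 = 0" "dd_succ 0 a = 0" "dd_succ a 0 = 0"
  using dd.prec_scale_left[of 0 0 a] dd.prec_scale_right[of a 0 0]
    dd.succ_scale_left[of 0 0 a] dd.succ_scale_right[of a 0 0] by simp_all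

lemmas dd_bilinear =
  dd.prec_add_left dd.prec_add_right dd.prec_scale_left dd.prec_scale_right
  dd.succ_add_left dd.succ_add_right dd.succ_scale_left dd.succ_scale_right

lemma gen_prec_component:
  assumes "x \<in> X" "a \<in> DD_component X m"
  shows "dd_prec (dd_gen x) a \<in> DD_component X (Suc m)"
  using assms(2)
proof (induction rule: DD_component_induct)
  case (word w)
  then have "Prec (Gen x) w \<in> normal_words X"
    using assms(1) by (auto intro: normal_words.intros)
  from normal_word_in_component[OF this] word show ?case by simp
qed (auto simp: dd_bilinear intro: component_closed)

lemma gen_succ_component:
  assumes "x \<in> X" "a \<in> DD_component X m"
  shows "dd_succ (dd_gen x) a \<in> DD_component X (Suc m)"
  using assms(2)
proof (induction rule: DD_component_induct)
  case (word w)
  then have "Succ (Gen x) w \<in> normal_words X"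
    using assms(1) by (auto intro: normal_words.intros)
  from normal_word_in_component[OF this] word show ?case by simp
qed (auto simp: dd_bilinear intro: component_closed)

lemma gen_succ_succ_component:
  assumes "x \<in> X" "a \<in> DD_component X i" "b \<in> DD_component X j"
  shows "dd_succ (dd_succ (dd_gen x) a) b \<in> DD_component X (Suc (i + j))"
  using assms(2)
proof (induction rule: DD_component_induct)
  case (word u)
  show ?case
    using assms(3)
  proof (induction rule: DD_component_induct)
    case (word v)
    then have "Succ (Succ (Gen x) u) v \<in> normal_words X"
      using assms(1) \<open>u \<in> normal_words X\<close> by (auto intro: normal_words.intros)
    from normal_word_in_component[OF this] word \<open>word_degree u = i\<close> show ?case
      by (simp add: add_ac)
  qed (auto simp: dd_bilinear intro: component_closed)
qed (auto simp: dd_bilinear intro: component_closed)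

text \<open>Induction on the left factor, with \<open>b\<close> arbitrary: the axioms move a product
  with \<open>b\<close> into the right arguments of \<open>u\<close>, until each summand begins with
  \<open>x\<close> or \<open>x\<close> \<succ> \<open>a\<close> and one of the four normal shapes
  applies. The third axiom is solved for \<open>(x \<prec> y) \<succ> z\<close>, whence the
  differences.\<close>

lemma normal_word_mult_component:
  fixes b :: "('x, 'k::field) dd"
  assumes "u \<in> normal_words X" "b \<in> DD_component X j"
  shows "dd_prec (word_eval u) b \<in> DD_component X (word_degree u + j) \<and>
         dd_succ (word_eval u) b \<in> DD_component X (word_degree u + j)"
  using assms
proof (induction arbitrary: b j)
  case (1 x)
  then show ?case by (simp add: gen_prec_component gen_succ_component)
next
  case (2 x v)
  have p: "dd_prec (word_eval v) b \<in> DD_component X (word_degree v + j)"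
    and s: "dd_succ (word_eval v) b \<in> DD_component X (word_degree v + j)"
    using 2 by auto
  have "dd_prec (dd_prec (dd_gen x) (word_eval v)) b =
      dd_prec (dd_gen x) (dd_prec (word_eval v) b) + dd_prec (dd_gen x) (dd_succ (word_eval v) b)"
    by (rule dd.prec_prec)
  moreover have "dd_succ (dd_prec (dd_gen x) (word_eval v)) b =
      dd_succ (dd_gen x) (dd_succ (word_eval v) b) - dd_succ (dd_succ (dd_gen x) (word_eval v)) b"
    by (simp add: dd.succ_succ)
  ultimately show ?case
    using gen_prec_component[OF 2(1) p] gen_prec_component[OF 2(1) s]
      gen_succ_component[OF 2(1) s]
      gen_succ_succ_component[OF 2(1) normal_word_in_component[OF 2(2)] 2(4)]
    by (simp add: component_closed)
next
  case (3 x v)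
  have p: "dd_prec (word_eval v) b \<in> DD_component X (word_degree v + j)"
    using 3 by auto
  show ?case
    using gen_succ_component[OF 3(1) p]
      gen_succ_succ_component[OF 3(1) normal_word_in_component[OF 3(2)] 3(4)]
    by (simp add: dd.succ_prec)
next
  case (4 x u1 u2)
  let ?x = "dd_gen x :: ('x, 'k) dd" and ?u = "word_eval u1 :: ('x, 'k) dd"
    and ?v = "word_eval u2 :: ('x, 'k) dd"
  note u = normal_word_in_component[OF 4(2)] and v = normal_word_in_component[OF 4(3)]
  \<comment> \<open>The third membership is the induction hypothesis for \<open>u1\<close> with
    \<open>u2\<close> as right factor. It serves the term arising from
    \<open>(x \<succ> u1) \<prec> u2 = x \<succ> (u1 \<prec> u2)\<close>.\<close>
  have "dd_prec ?v b \<in> DD_component X (word_degree u2 + j)"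
    "dd_succ ?v b \<in> DD_component X (word_degree u2 + j)"
    "dd_prec ?u ?v \<in> DD_component X (word_degree u1 + word_degree u2)"
    using 4(4)[OF v] 4(5,6) by auto
  note m = this[THEN gen_succ_succ_component[OF 4(1) u]]
    gen_succ_succ_component[OF 4(1) this(3) 4(6)]
  have "dd_prec (dd_succ (dd_succ ?x ?u) ?v) b = dd_succ (dd_succ ?x ?u) (dd_prec ?v b)"
    by (rule dd.succ_prec)
  moreover have "dd_succ (dd_succ (dd_succ ?x ?u) ?v) b =
      dd_succ (dd_succ ?x ?u) (dd_succ ?v b) - dd_succ (dd_succ ?x (dd_prec ?u ?v)) b"
    by (simp add: dd.succ_succ[of "dd_succ ?x ?u"] dd.succ_prec)
  ultimately show ?case
    using m by (simp add: component_closed add_ac)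
qed

lemma DD_component_mult:
  assumes "a \<in> DD_component X i" "b \<in> DD_component X j"
  shows "dd_prec a b \<in> DD_component X (i + j)" "dd_succ a b \<in> DD_component X (i + j)"
proof -
  have "dd_prec a b \<in> DD_component X (i + j) \<and> dd_succ a b \<in> DD_component X (i + j)"
    using assms(1)
    by (induction rule: DD_component_induct)
      (use normal_word_mult_component[OF _ assms(2)] in
        \<open>auto simp: dd_bilinear intro: component_closed\<close>)
  then show "dd_prec a b \<in> DD_component X (i + j)" "dd_succ a b \<in> DD_component X (i + j)"
    by auto
qed

section \<open>Words over a labelled alphabet\<close>

text \<open>Labels are shifted by one, so that only the empty word has maximum \<open>0\<close>.\<close>

primrec hi :: "('x \<times> nat) list \<Rightarrow> nat" where
  "hi [] = 0"
| "hi (a # w) = max (Suc (snd a)) (hi w)"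

lemma hi_append [simp]: "hi (u @ v) = max (hi u) (hi v)"
  by (induction u) auto

lemma hi_eq_0_iff [simp]: "hi w = 0 \<longleftrightarrow> w = []"
  by (cases w) auto

definition splits :: "(nat \<Rightarrow> nat \<Rightarrow> bool) \<Rightarrow> ('x \<times> nat) list \<Rightarrow>
    (('x \<times> nat) list \<times> ('x \<times> nat) list) set" where
  "splits R w = {(u, v). u @ v = w \<and> R (hi u) (hi v)}"

text \<open>Arbitrary functions are allowed, not only finitely supported ones: a word has finitely
  many splittings, so the sum is finite even for \<open>wgen\<close>, whose support is infinite when
  all labels occur.\<close>

definition conv :: "(nat \<Rightarrow> nat \<Rightarrow> bool) \<Rightarrow> (('x \<times> nat) list \<Rightarrow> 'k::field) \<Rightarrow>
    (('x \<times> nat) list \<Rightarrow> 'k) \<Rightarrow> ('x \<times> nat) list \<Rightarrow> 'k" where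
  "conv R f g w = (\<Sum>(u, v)\<in>splits R w. f u * g v)"

lemma finite_splits [simp]: "finite (splits R w)"
proof (rule finite_subset)
  show "splits R w \<subseteq> (\<lambda>i. (take i w, drop i w)) ` {..length w}"
  proof clarify
    fix u v assume "(u, v) \<in> splits R w"
    then have "(u, v) = (take (length u) w, drop (length u) w)" "length u \<le> length w"
      by (auto simp: splits_def)
    then show "(u, v) \<in> (\<lambda>i. (take i w, drop i w)) ` {..length w}"
      by (intro image_eqI[of _ _ "length u"]) (simp_all only: atMost_iff)
  qed
qed auto

text \<open>Both bracketings become sums over factorizations into three words, so the dendriform
  axioms reduce to comparisons of three maxima.\<close>

lemma conv_conv_left:
  "conv R (conv S f g) h w =
    (\<Sum>(u, v, z) | u @ v @ z = w \<and> S (hi u) (hi v) \<and> R (max (hi u) (hi v)) (hi z).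
      f u * g v * h z)"
proof -
  have "conv R (conv S f g) h w =
      (\<Sum>p\<in>splits R w. \<Sum>q\<in>splits S (fst p). f (fst q) * g (snd q) * h (snd p))"
    by (simp add: conv_def sum_distrib_right case_prod_unfold)
  also have "\<dots> = (\<Sum>(p, q)\<in>(SIGMA p:splits R w. splits S (fst p)).
      f (fst q) * g (snd q) * h (snd p))"
    by (simp add: sum.Sigma)
  also have "\<dots> = (\<Sum>(u, v, z) | u @ v @ z = w \<and> S (hi u) (hi v) \<and> R (max (hi u) (hi v)) (hi z).
      f u * g v * h z)"
    by (rule sum.reindex_bij_witness[of _ "\<lambda>(u, v, z). ((u @ v, z), (u, v))"
          "\<lambda>(p, q). (fst q, snd q, snd p)"])
      (auto simp: splits_def)
  finally show ?thesis .
qed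

lemma conv_conv_right:
  "conv R f (conv S g h) w =
    (\<Sum>(u, v, z) | u @ v @ z = w \<and> S (hi v) (hi z) \<and> R (hi u) (max (hi v) (hi z)).
      f u * g v * h z)"
proof -
  have "conv R f (conv S g h) w =
      (\<Sum>p\<in>splits R w. \<Sum>q\<in>splits S (snd p). f (fst p) * g (fst q) * h (snd q))"
    by (simp add: conv_def sum_distrib_left case_prod_unfold mult.assoc)
  also have "\<dots> = (\<Sum>(p, q)\<in>(SIGMA p:splits R w. splits S (snd p)).
      f (fst p) * g (fst q) * h (snd q))"
    by (simp add: sum.Sigma)
  also have "\<dots> = (\<Sum>(u, v, z) | u @ v @ z = w \<and> S (hi v) (hi z) \<and> R (hi u) (max (hi v) (hi z)).
      f u * g v * h z)"
    by (rule sum.reindex_bij_witness[of _ "\<lambda>(u, v, z). ((u, v @ z), (v, z))"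
          "\<lambda>(p, q). (fst p, fst q, snd q)"])
      (auto simp: splits_def)
  finally show ?thesis .
qed

abbreviation "wprec \<equiv> conv (>)"
abbreviation "wsucc \<equiv> conv (\<le>)"

definition wscale :: "'k::field \<Rightarrow> (('x \<times> nat) list \<Rightarrow> 'k) \<Rightarrow> ('x \<times> nat) list \<Rightarrow> 'k" where
  "wscale c f = (\<lambda>w. c * f w)"

lemma conv_bilinear:
  "conv R (f + g) h = conv R f h + conv R g h"
  "conv R f (g + h) = conv R f g + conv R f h"
  "conv R (wscale c f) h = wscale c (conv R f h)"
  "conv R f (wscale c h) = wscale c (conv R f h)"
  by (auto simp: fun_eq_iff conv_def wscale_def case_prod_unfold sum_distrib_left
      sum.distrib algebra_simps)

lemma wprec_plus_wsucc:
  fixes f g :: "('x \<times> nat) list \<Rightarrow> 'k::field"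
  shows "wprec f g + wsucc f g = conv (\<lambda>_ _. True) f g"
proof
  fix w :: "('x \<times> nat) list"
  have "splits (\<lambda>_ _. True) w = splits (>) w \<union> splits (\<le>) w"
    and "splits (>) w \<inter> splits (\<le>) w = {}"
    by (auto simp: splits_def)
  then show "(wprec f g + wsucc f g) w = conv (\<lambda>_ _. True) f g w"
    by (simp add: conv_def sum.union_disjoint)
qed

text \<open>The axioms sort the factorizations \<open>u @ v @ z\<close> by where the maximum lies.
  The first one says on both sides that \<open>v\<close> dominates (weakly over \<open>u\<close>,
  strictly over \<open>z\<close>), the second that \<open>u\<close> strictly dominates both others,
  the third that \<open>z\<close> weakly dominates both others.\<close>

lemma dendriform_words: "dendriform_algebra wscale wprec wsucc"
proof
  fix f g h :: "('x \<times> nat) list \<Rightarrow> 'k::field"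
  show "wprec (wsucc f g) h = wsucc f (wprec g h)"
    by (rule ext) (auto simp: conv_conv_left conv_conv_right intro!: sum.cong)
  have "wprec (wprec f g) h = wprec f (conv (\<lambda>_ _. True) g h)"
    by (rule ext) (auto simp: conv_conv_left conv_conv_right intro!: sum.cong)
  then show "wprec (wprec f g) h = wprec f (wprec g h) + wprec f (wsucc g h)"
    by (simp only: wprec_plus_wsucc[symmetric] conv_bilinear(2))
  have "wsucc f (wsucc g h) = wsucc (conv (\<lambda>_ _. True) f g) h"
    by (rule ext) (auto simp: conv_conv_left conv_conv_right intro!: sum.cong)
  then show "wsucc f (wsucc g h) = wsucc (wsucc f g) h + wsucc (wprec f g) h"
    by (simp only: wprec_plus_wsucc[symmetric] conv_bilinear(1) add.commute)
next
  fix f g :: "('x \<times> nat) list \<Rightarrow> 'k::field" and a b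
  show "wscale a (f + g) = wscale a f + wscale a g" "wscale (a + b) f = wscale a f + wscale b f"
    "wscale a (wscale b f) = wscale (a * b) f" "wscale 1 f = f"
    by (simp_all add: wscale_def fun_eq_iff algebra_simps)
qed (rule conv_bilinear)+

section \<open>The unit and the images of the generators\<close>

definition wone :: "('x \<times> nat) list \<Rightarrow> 'k::field" where
  "wone w = of_bool (w = [])"

text \<open>The label is left free because one generator must serve at tree nodes of every
  height.\<close>

definition wgen :: "'x \<Rightarrow> ('x \<times> nat) list \<Rightarrow> 'k::field" where
  "wgen x w = of_bool (\<exists>n. w = [(x, n)])"

lemma wsucc_wone:
  fixes f :: "('x \<times> nat) list \<Rightarrow> 'k::field"
  shows "wsucc wone f = f"
proof
  fix w :: "('x \<times> nat) list"
  have "wsucc wone f w = (\<Sum>(u, v)\<in>{([] :: ('x \<times> nat) list, w)}. wone u * f v)"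
    unfolding conv_def
    by (rule sum.mono_neutral_right, simp) (auto simp: splits_def wone_def)
  then show "wsucc wone f w = f w"
    by (simp add: wone_def)
qed

text \<open>The empty word has no splitting with \<open>hi u > hi v\<close>, so the product vanishes
  at \<open>[]\<close>; elsewhere \<open>w @ []\<close> is the only contributing splitting.\<close>

lemma wprec_wone:
  fixes f :: "('x \<times> nat) list \<Rightarrow> 'k::field"
  assumes "f [] = 0"
  shows "wprec f wone = f"
proof
  fix w :: "('x \<times> nat) list"
  have "wprec f wone w =
      (\<Sum>(u, v)\<in>(if w = [] then {} else {(w, [] :: ('x \<times> nat) list)}). f u * wone v)"
    unfolding conv_def
    by (rule sum.mono_neutral_right, simp)
      (auto simp: splits_def wone_def assms neq0_conv[symmetric] split: if_splits)
  then show "wprec f wone w = f w"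
    using assms by (simp add: wone_def)
qed

section \<open>Trees\<close>

text \<open>
  \<open>Leaf\<close> stands for an absent unit: \<open>tree_eval Leaf = 0\<close> is a junk value, whereas
  \<open>tree_fun Leaf\<close> is the unit of the concatenation product.
\<close>

fun tree_eval :: "'x tree \<Rightarrow> ('x, 'k::field) dd" where
  "tree_eval Leaf = 0"
| "tree_eval (Node l x r) =
    (let a = (if l = Leaf then dd_gen x else dd_succ (tree_eval l) (dd_gen x))
     in if r = Leaf then a else dd_prec a (tree_eval r))"

primrec tree_fun :: "'x tree \<Rightarrow> ('x \<times> nat) list \<Rightarrow> 'k::field" where
  "tree_fun Leaf = wone"
| "tree_fun (Node l x r) = wprec (wsucc (tree_fun l) (wgen x)) (tree_fun r)"

text \<open>The label is the height of the node minus one, to match the shift in \<open>hi\<close>.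
  The root thus carries the unique largest label of the word.\<close>

primrec tree_word :: "'x tree \<Rightarrow> ('x \<times> nat) list" where
  "tree_word Leaf = []"
| "tree_word (Node l x r) = tree_word l @ (x, max (height l) (height r)) # tree_word r"

lemma hi_tree_word [simp]: "hi (tree_word t) = height t"
  by (induction t) auto

text \<open>A factorization contributes only if its middle part is a single letter whose label is at
  least those to its left and exceeds those to its right. The letter with label \<open>m\<close>
  strictly exceeds all others, so it must be that letter and one term survives.\<close>

lemma tree_product_at_peak:
  assumes "hi u \<le> m" "hi v \<le> m"
  shows "wprec (wsucc f (wgen x)) g (u @ (y, m) # v) = f u * of_bool (x = y) * g v"
proof -
  let ?S = "{(p, q, z). p @ q @ z = u @ (y, m) # v \<and> hi p \<le> hi q \<and> hi z < max (hi p) (hi q)}"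
  have only: "(p, z) = (u, v)"
    if eq: "p @ (x', n) # z = u @ (y, m) # v" and "hi p \<le> Suc n" "hi z \<le> n" for p z x' n
    using eq unfolding append_eq_append_conv2
  proof (elim exE disjE conjE)
    \<comment> \<open>If \<open>t\<close> is nonempty, the peak lies in \<open>p\<close> while
      \<open>(x', n)\<close> lies in \<open>v\<close>: then \<open>m \<le> n\<close> and
      \<open>n < m\<close>. The other case is symmetric, with the peak in \<open>z\<close> and
      \<open>(x', n)\<close> in \<open>u\<close>.\<close>
    fix t assume "p = u @ t" "t @ (x', n) # z = (y, m) # v"
    then show ?thesis using that(2) assms by (cases t) auto
  next
    fix t assume "p @ t = u" "(x', n) # z = t @ (y, m) # v"
    then show ?thesis using that(3) assms by (cases t) auto
  qed
  have fin: "finite ?S"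
  proof (rule finite_subset)
    show "?S \<subseteq> (\<lambda>((a, z), (p, q)). (p, q, z)) `
        (SIGMA s:splits (\<lambda>_ _. True) (u @ (y, m) # v). splits (\<lambda>_ _. True) (fst s))"
      by (force simp: splits_def image_iff)
  qed auto
  have "wprec (wsucc f (wgen x)) g (u @ (y, m) # v) = (\<Sum>(p, q, z)\<in>?S. f p * wgen x q * g z)"
    by (simp add: conv_conv_left)
  also have "\<dots> = (\<Sum>(p, q, z)\<in>{(u, [(y, m)], v)}. f p * wgen x q * g z)"
  proof (rule sum.mono_neutral_right[OF fin])
    show "{(u, [(y, m)], v)} \<subseteq> ?S" using assms by auto
    show "\<forall>i\<in>?S - {(u, [(y, m)], v)}. (case i of (p, q, z) \<Rightarrow> f p * wgen x q * g z) = 0"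
    proof
      fix i assume i: "i \<in> ?S - {(u, [(y, m)], v)}"
      obtain p q z where [simp]: "i = (p, q, z)"
        by (cases i)
      have "\<nexists>n. q = [(x, n)]"
      proof
        assume "\<exists>n. q = [(x, n)]"
        then obtain n where q: "q = [(x, n)]" ..
        with i have "p @ (x, n) # z = u @ (y, m) # v" "hi p \<le> Suc n" "hi z \<le> n"
          by auto
        moreover from only[OF this] have "p = u" "z = v" by auto
        ultimately show False using i q by auto
      qed
      then show "(case i of (p, q, z) \<Rightarrow> f p * wgen x q * g z) = 0"
        by (simp add: wgen_def)
    qed
  qed
  also have "\<dots> = f u * of_bool (x = y) * g v"
    by (auto simp: wgen_def)
  finally show ?thesis .
qed

lemma tree_fun_Node_Nil: "tree_fun (Node l x r) [] = 0"
  by (auto simp: conv_def splits_def intro!: sum.neutral)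

text \<open>Duality of tree monomials and tree words: the root of \<open>t\<close> is the peak of
  its word, so the value factors into the root comparison and the values at the two
  subtrees.\<close>

lemma tree_fun_tree_word: "tree_fun s (tree_word t) = of_bool (s = t)"
proof (induction t arbitrary: s)
  case Leaf
  then show ?case
    by (cases s) (simp_all add: wone_def tree_fun_Node_Nil del: tree_fun.simps(2))
next
  case (Node l y r)
  then show ?case
    by (cases s) (auto simp: wone_def tree_product_at_peak)
qed

lemma tree_eval_component:
  assumes "set_tree t \<subseteq> X" "t \<noteq> Leaf"
  shows "(tree_eval t :: ('x, 'k::field) dd) \<in> DD_component X (size t)"
  using assms
proof (induction t)
  case (Node l x r)
  have x: "(dd_gen x :: ('x, 'k) dd) \<in> DD_component X 1"
    using normal_word_in_component[OF normal_words.intros(1), of x X] Node.prems by simp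
  have a: "(if l = Leaf then dd_gen x else dd_succ (tree_eval l) (dd_gen x :: ('x, 'k) dd))
      \<in> DD_component X (Suc (size l))"
    using Node x DD_component_mult(2)[OF _ x, of "tree_eval l" "size l"] by auto
  show ?case
  proof (cases "r = Leaf")
    case True
    then show ?thesis using a by simp
  next
    case False
    then have "(tree_eval r :: ('x, 'k) dd) \<in> DD_component X (size r)"
      using Node by auto
    from DD_component_mult(1)[OF a this] False show ?thesis
      by (simp add: Let_def)
  qed
qed auto

text \<open>\<open>tree_eval\<close> omits an absent factor where \<open>tree_fun\<close> multiplies
  by \<open>wone\<close>; the two agree by the unit laws. Membership in \<open>DD X\<close> is
  tracked because \<open>\<phi>\<close> is a homomorphism only there.\<close>

lemma hom_tree_eval:
  fixes \<phi> :: "('x, 'k::field) dd \<Rightarrow> ('x \<times> nat) list \<Rightarrow> 'k"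
  assumes hom: "dendriform_hom_on (DD X) dd_scale dd_prec dd_succ wscale wprec wsucc \<phi>"
    and gen: "\<And>x. x \<in> X \<Longrightarrow> \<phi> (dd_gen x) = wgen x"
    and "set_tree t \<subseteq> X" "t \<noteq> Leaf"
  shows "\<phi> (tree_eval t) = tree_fun t"
  using assms(3,4)
proof (induction t)
  case (Node l x r)
  have DD: "(tree_eval t :: ('x, 'k) dd) \<in> DD X" if "set_tree t \<subseteq> X" for t
    using tree_eval_component[OF that] DD_component_subset DD_closed(2) by (cases "t = Leaf") auto
  let ?a = "if l = Leaf then dd_gen x else dd_succ (tree_eval l) (dd_gen x :: ('x, 'k) dd)"
  have x: "(dd_gen x :: ('x, 'k) dd) \<in> DD X"
    using Node.prems by (simp add: dd_gen_in_DD)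
  then have a: "?a \<in> DD X"
    using Node.prems DD[of l] by (auto intro: DD_closed(4))
  have "\<phi> ?a = wsucc (tree_fun l) (wgen x)"
    using Node hom DD[of l] x by (auto simp: gen wsucc_wone dendriform_hom_on_def)
  moreover have "wsucc f (wgen x) [] = 0" for f :: "('x \<times> nat) list \<Rightarrow> 'k"
    by (auto simp: conv_def splits_def wgen_def intro!: sum.neutral)
  ultimately show ?case
    using Node hom a DD[of r]
    by (cases "r = Leaf") (auto simp: Let_def wprec_wone dendriform_hom_on_def)
qed auto

section \<open>Linear independence of the tree monomials\<close>

definition trees :: "'x set \<Rightarrow> nat \<Rightarrow> 'x tree set" where
  "trees X m = {t. set_tree t \<subseteq> X \<and> size t = m}"

lemma independent_tree_eval:
  assumes "m > 0"
  shows "dd.independent (tree_eval ` trees X m :: ('x, 'k::field) dd set)"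
    and "inj_on (tree_eval :: _ \<Rightarrow> ('x, 'k) dd) (trees X m)"
proof -
  obtain \<phi> :: "('x, 'k) dd \<Rightarrow> ('x \<times> nat) list \<Rightarrow> 'k" where
    hom: "dendriform_hom_on (DD X) dd_scale dd_prec dd_succ wscale wprec wsucc \<phi>"
    and gen: "\<And>x. x \<in> X \<Longrightarrow> \<phi> (dd_gen x) = wgen x"
    using DD_universal(1)[OF dendriform_words, of X wgen] by blast
  have \<phi>: "\<phi> (tree_eval s) (tree_word t) = of_bool (s = t)" if "s \<in> trees X m" for s t
  proof -
    have "set_tree s \<subseteq> X" "s \<noteq> Leaf"
      using that assms by (auto simp: trees_def)
    then show ?thesis
      by (simp add: hom_tree_eval[OF hom gen] tree_fun_tree_word)
  qed
  have DD: "tree_eval t \<in> (DD X :: ('x, 'k) dd set)" if "t \<in> trees X m" for t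
    using that assms
    by (intro subsetD[OF DD_component_subset tree_eval_component]) (auto simp: trees_def)
  show inj: "inj_on (tree_eval :: _ \<Rightarrow> ('x, 'k) dd) (trees X m)"
    by (rule inj_onI) (metis \<phi> of_bool_eq_iff)
  show "dd.independent (tree_eval ` trees X m :: ('x, 'k) dd set)"
    unfolding dd.dependent_def
  proof clarify
    fix t assume t: "t \<in> trees X m"
      and "(tree_eval t :: ('x, 'k) dd) \<in> dd.span (tree_eval ` trees X m - {tree_eval t})"
    \<comment> \<open>Evaluation at \<open>tree_word t\<close> is a linear functional on
      \<open>DD X\<close> that kills all tree monomials of size \<open>m\<close> except that of
      \<open>t\<close>, where it is 1.\<close>
    moreover have "dd.span (tree_eval ` trees X m - {tree_eval t})
        \<subseteq> {a \<in> DD X. \<phi> a (tree_word t) = 0}"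
    proof (rule dd.span_minimal)
      show "tree_eval ` trees X m - {tree_eval t} \<subseteq> {a \<in> DD X. \<phi> a (tree_word t) = 0}"
        using \<phi> DD by auto
      \<comment> \<open>Preservation of zero is not among the clauses of
        \<open>dendriform_hom_on\<close>; it follows from scaling by 0.\<close>
      have "\<phi> (dd_scale 0 0) = wscale 0 (\<phi> 0)"
        using hom DD_closed(2) unfolding dendriform_hom_on_def by blast
      then have "\<phi> 0 = 0" by (simp add: wscale_def fun_eq_iff)
      then show "dd.subspace {a \<in> DD X. \<phi> a (tree_word t) = 0}"
        using hom DD_closed(1,2)[of X]
        by (intro dd.subspaceI)
          (auto simp: dendriform_hom_on_def wscale_def
            intro: dd.subspace_add[OF DD_closed(1)] dd.subspace_scale[OF DD_closed(1)])
    qed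
    ultimately show False using \<phi>[OF t, of t] by auto
  qed
qed

section \<open>Normal words as images of trees\<close>

fun normal_of_tree :: "'x tree \<Rightarrow> 'x dd_word" where
  "normal_of_tree (Node l x r) =
    (if l = Leaf then if r = Leaf then Gen x else Prec (Gen x) (normal_of_tree r)
     else if r = Leaf then Succ (Gen x) (normal_of_tree l)
     else Succ (Succ (Gen x) (normal_of_tree l)) (normal_of_tree r))"

text \<open>Surjectivity bounds the number of normal words by the number of trees. The
  correspondence is purely combinatorial: no claim is made about the values in \<open>DD X\<close>.
  \<open>Leaf\<close> is excluded since \<open>normal_of_tree\<close> has no equation for
  it.\<close>

lemma normal_word_tree:
  assumes "w \<in> normal_words X"
  shows "\<exists>t. t \<noteq> Leaf \<and> t \<in> trees X (word_degree w) \<and> normal_of_tree t = w"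
  using assms
proof induction
  case (1 x)
  then show ?case by (intro exI[of _ "Node Leaf x Leaf"]) (auto simp: trees_def)
next
  case (2 x v)
  then obtain t where "t \<noteq> Leaf" "t \<in> trees X (word_degree v)" "normal_of_tree t = v" by blast
  with 2 show ?case by (intro exI[of _ "Node Leaf x t"]) (auto simp: trees_def)
next
  case (3 x v)
  then obtain t where "t \<noteq> Leaf" "t \<in> trees X (word_degree v)" "normal_of_tree t = v" by blast
  with 3 show ?case by (intro exI[of _ "Node t x Leaf"]) (auto simp: trees_def)
next
  case (4 x u v)
  then obtain s t where "s \<noteq> Leaf" "s \<in> trees X (word_degree u)" "normal_of_tree s = u"
    "t \<noteq> Leaf" "t \<in> trees X (word_degree v)" "normal_of_tree t = v" by blast
  with 4 show ?case by (intro exI[of _ "Node s x t"]) (auto simp: trees_def)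
qed

section \<open>Counting\<close>

lemma trees_0: "trees X 0 = {Leaf}"
  by (auto simp: trees_def)

lemma trees_Suc:
  "trees X (Suc m) = (\<Union>i\<le>m. (\<lambda>(l, x, r). Node l x r) ` (trees X i \<times> X \<times> trees X (m - i)))"
proof (intro equalityI subsetI)
  fix t assume t: "t \<in> trees X (Suc m)"
  then obtain l x r where "t = Node l x r"
    by (cases t) (auto simp: trees_def)
  with t show "t \<in> (\<Union>i\<le>m. (\<lambda>(l, x, r). Node l x r) ` (trees X i \<times> X \<times> trees X (m - i)))"
    by (intro UN_I[of "size l"] image_eqI[of _ _ "(l, x, r)"]) (auto simp: trees_def)
qed (auto simp: trees_def)

lemma finite_trees:
  assumes "finite X"
  shows "finite (trees X m)"
proof (induction m rule: less_induct)
  case (less m)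
  show ?case
  proof (cases m)
    case 0
    then show ?thesis by (simp add: trees_0)
  next
    case (Suc k)
    then show ?thesis using less assms by (auto simp: trees_Suc)
  qed
qed

lemma card_trees_Suc:
  assumes "finite X"
  shows "card (trees X (Suc m)) = card X * (\<Sum>i\<le>m. card (trees X i) * card (trees X (m - i)))"
proof -
  let ?N = "\<lambda>(l, x, r). Node l x r"
  have "card (trees X (Suc m)) = (\<Sum>i\<le>m. card (?N ` (trees X i \<times> X \<times> trees X (m - i))))"
    unfolding trees_Suc
  proof (rule card_UN_disjoint)
    show "\<forall>i\<in>{..m}. finite (?N ` (trees X i \<times> X \<times> trees X (m - i)))"
      by (simp add: assms finite_trees)
  qed (auto simp: trees_def)
  also have "\<dots> = (\<Sum>i\<le>m. card (trees X i \<times> X \<times> trees X (m - i)))"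
    by (intro sum.cong refl card_image) (auto simp: inj_on_def)
  also have "\<dots> = card X * (\<Sum>i\<le>m. card (trees X i) * card (trees X (m - i)))"
    by (simp add: card_cartesian_product sum_distrib_left mult_ac)
  finally show ?thesis .
qed

section \<open>Catalan numbers and their generating function\<close>

definition catalan :: "nat \<Rightarrow> rat" where
  "catalan m = fact (2 * m) / (fact (m + 1) * fact m)"

text \<open>This is the coefficient form of the differential equation for \<open>E\<close> in
  \<open>catalan_convolution\<close>.\<close>

lemma catalan_Suc: "of_nat (m + 2) * catalan (Suc m) = of_nat (4 * m + 2) * catalan m"
proof -
  have num: "fact (2 * Suc m) = (2 * of_nat m + 2) * (2 * of_nat m + 1) * (fact (2 * m) :: rat)"
    by (simp add: algebra_simps)
  have den: "fact (Suc m + 1) = (of_nat m + 2) * (of_nat m + 1) * (fact m :: rat)"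
    "fact (Suc m) = (of_nat m + 1) * (fact m :: rat)" "fact (m + 1) = (of_nat m + 1) * (fact m :: rat)"
    by (simp_all add: algebra_simps)
  \<comment> \<open>With the factorials replaced by variables, an identity of rational functions
    remains.\<close>
  have "(x + 2) * ((2 * x + 2) * (2 * x + 1) * F / ((x + 2) * (x + 1) * f * ((x + 1) * f))) =
      (4 * x + 2) * (F / ((x + 1) * f * f))" if "x \<ge> 0" "f \<noteq> 0" for x F f :: rat
  proof -
    have "x + 1 \<noteq> 0" "x + 2 \<noteq> 0" using that by auto
    with that show ?thesis by (simp add: divide_simps) (simp add: algebra_simps)
  qed
  note this[of "of_nat m" "fact m" "fact (2 * m)", OF of_nat_0_le_iff fact_nonzero]
  moreover have "of_nat (m + 2) = (of_nat m + 2 :: rat)" "of_nat (4 * m + 2) = (4 * of_nat m + 2 :: rat)"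
    by simp_all
  ultimately show ?thesis
    unfolding catalan_def num den by (simp only:)
qed

text \<open>Comparing coefficients gives \<open>(n + 1) * F_(n+1) = 4 * (n - 1) * F_n\<close>, so
  the zero constant term propagates.\<close>

lemma fps_ode_zero:
  fixes F :: "rat fps"
  assumes "(1 - 4 * fps_X) * fps_deriv F = - 4 * F" "fps_nth F 0 = 0"
  shows "F = 0"
proof (rule fps_ext)
  fix n show "fps_nth F n = fps_nth 0 n"
  proof (induction n)
    case (Suc n)
    have "fps_deriv F = 4 * (fps_X * fps_deriv F) - 4 * F"
      using assms(1) by (simp add: algebra_simps)
    from arg_cong[OF this, of "\<lambda>F. fps_nth F n"] Suc show ?case
      by (cases n) (simp_all add: fps_numeral_fps_const add_eq_0_iff)
  qed (use assms(2) in simp)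
qed

lemma catalan_convolution:
  "catalan (Suc m) = (\<Sum>i\<le>m. catalan i * catalan (m - i))"
proof -
  define D where "D = Abs_fps catalan"
  \<comment> \<open>\<open>E\<close> plays the role of the square root of \<open>1 - 4t\<close>,
    characterized below by its differential equation.\<close>
  define E where "E = 1 - 2 * (fps_X * D)"
  define G where "G = (1 - 4 * fps_X :: rat fps)"
  have E_nth: "fps_nth E (Suc n) = - 2 * catalan n" for n
    by (simp add: E_def D_def fps_numeral_fps_const)
  have "fps_nth (fps_deriv E) n = fps_nth (4 * (fps_X * fps_deriv E) - 2 * E) n" for n
  proof (cases n)
    case 0
    then show ?thesis
      by (simp add: E_nth fps_numeral_fps_const) (simp add: E_def catalan_def)
  next
    case (Suc k)
    then show ?thesis
      using catalan_Suc[of k] by (simp add: E_nth fps_numeral_fps_const algebra_simps)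
  qed
  then have "fps_deriv E = 4 * (fps_X * fps_deriv E) - 2 * E"
    by (rule fps_ext)
  then have ode: "G * fps_deriv E = - 2 * E"
    by (simp add: G_def algebra_simps)
  \<comment> \<open>The product rule gives \<open>2 * E * E' + 4\<close>; inserting the equation for
    \<open>E\<close> turns the right side into \<open>-4 * E * E + 4 * G\<close>.\<close>
  have "G * fps_deriv (E * E - G) = 2 * E * (G * fps_deriv E) + 4 * G"
    by (simp add: G_def algebra_simps)
  also have "\<dots> = - 4 * (E * E - G)"
    unfolding ode by (simp add: algebra_simps)
  finally have "E * E - G = 0"
    unfolding G_def by (rule fps_ode_zero) (simp add: E_def)
  \<comment> \<open>Here \<open>E * E - G\<close> equals \<open>-4t * (D - 1 - t * D * D)\<close>;
    the factor \<open>4t\<close> cancels since formal power series over \<open>rat\<close> have no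
    zero divisors.\<close>
  then have "4 * fps_X * (D - 1 - fps_X * (D * D)) = 0"
    by (simp add: E_def G_def algebra_simps)
  moreover have "fps_nth (4 * fps_X :: rat fps) 1 \<noteq> 0"
    by (simp add: fps_numeral_fps_const)
  then have "4 * fps_X \<noteq> (0 :: rat fps)"
    by (metis fps_zero_nth)
  ultimately have "D - 1 - fps_X * (D * D) = 0"
    by (simp only: mult_eq_0_iff simp_thms)
  then have "D = 1 + fps_X * (D * D)"
    by (simp add: algebra_simps)
  from arg_cong[OF this, of "\<lambda>F. fps_nth F (Suc m)"]
  have "fps_nth D (Suc m) = fps_nth (D * D) m"
    by simp
  then show ?thesis
    by (simp add: D_def fps_mult_nth atLeast0AtMost)
qed

lemma card_trees:
  assumes "finite X"
  shows "of_nat (card (trees X m)) = of_nat (card X) ^ m * catalan m"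
proof (induction m rule: less_induct)
  case (less m)
  show ?case
  proof (cases m)
    case 0
    then show ?thesis by (simp add: trees_0 catalan_def)
  next
    case (Suc k)
    have "of_nat (card (trees X m)) =
        of_nat (card X) * (\<Sum>i\<le>k. (of_nat (card X) ^ i * catalan i) *
          (of_nat (card X) ^ (k - i) * catalan (k - i)))"
      using less by (simp add: Suc card_trees_Suc[OF assms])
    also have "(\<Sum>i\<le>k. (of_nat (card X) ^ i * catalan i) *
          (of_nat (card X) ^ (k - i) * catalan (k - i))) =
        (\<Sum>i\<le>k. of_nat (card X) ^ k * (catalan i * catalan (k - i)))"
      by (rule sum.cong) (auto simp: power_add[symmetric] mult.left_commute mult.assoc
          simp flip: mult.assoc)
    finally show ?thesis
      by (simp add: Suc catalan_convolution sum_distrib_left mult_ac)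
  qed
qed

text \<open>A squeeze: the tree monomials are independent, and the normal words span and are no more
  numerous than the trees. A basis \<open>C\<close> extending the monomials therefore has exactly as
  many elements as there are trees.\<close>

lemma dim_DD_component:
  assumes "finite X" "m > 0"
  shows "dd.dim (DD_component X m :: ('x, 'k::field) dd set) = card (trees X m)"
proof -
  let ?V = "DD_component X m :: ('x, 'k) dd set"
  let ?B = "tree_eval ` trees X m :: ('x, 'k) dd set"
  let ?W = "word_eval ` {w \<in> normal_words X. word_degree w = m} :: ('x, 'k) dd set"
  have W: "{w \<in> normal_words X. word_degree w = m} \<subseteq> normal_of_tree ` trees X m"
    using normal_word_tree by fastforce
  have fN: "finite {w \<in> normal_words X. word_degree w = m}"
    using finite_subset[OF W] finite_trees[OF assms(1)] by blast
  then have fW: "finite ?W"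
    by (rule finite_imageI)
  have "card ?W \<le> card {w \<in> normal_words X. word_degree w = m}"
    by (rule card_image_le[OF fN])
  also have "\<dots> \<le> card (trees X m)"
    by (rule surj_card_le[OF finite_trees[OF assms(1)] W])
  finally have cW: "card ?W \<le> card (trees X m)" .
  have VW: "?V = dd.span ?W"
    by (rule DD_component_def)
  have BV: "?B \<subseteq> ?V"
    using tree_eval_component assms(2) by (fastforce simp: trees_def)
  obtain C where C: "?B \<subseteq> C" "C \<subseteq> ?V" "dd.independent C" "?V \<subseteq> dd.span C"
    using dd.maximal_independent_subset_extend[OF BV independent_tree_eval(1)[OF assms(2)]] by blast
  have C': "finite C" "card C \<le> card ?W"
    using dd.independent_span_bound[OF fW C(3)] C(2) VW by auto
  have "card (trees X m) = card ?B"
    by (simp add: card_image independent_tree_eval(2)[OF assms(2)])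
  also have "\<dots> \<le> card C"
    by (rule card_mono) fact+
  finally have "card C = card (trees X m)"
    using C' cW by simp
  then show ?thesis
    using dd.dim_unique[OF C(2,4,3)] by simp
qed

text \<open>The even factors of \<open>(2m)!\<close> multiply to \<open>2^m * m!\<close>, leaving
  the odd ones; this links the two forms of the series.\<close>

lemma odd_product: "(\<Prod>i=1..m. of_nat (2 * i - 1)) * 2 ^ m * fact m = (fact (2 * m) :: rat)"
proof (induction m)
  case (Suc m)
  have "(\<Prod>i=1..Suc m. of_nat (2 * i - 1)) * 2 ^ Suc m * (fact (Suc m) :: rat) =
      ((\<Prod>i=1..m. of_nat (2 * i - 1)) * 2 ^ m * fact m) * (of_nat (2 * m + 1) * 2 * of_nat (m + 1))"
    by simp
  also have "\<dots> = fact (2 * Suc m)"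
    unfolding Suc.IH by (simp add: algebra_simps)
  finally show ?case .
qed simp

theorem theorem4p5:
  fixes X :: "'x set" and n :: nat
  assumes "finite X" and "card X = n"
  shows "dd.hilbert_series (DD_component X :: nat \<Rightarrow> ('x, 'k::field) dd set) =
           Abs_fps (\<lambda>m. if m = 0 then 0
             else (\<Prod>i=1..m. of_nat (2 * i - 1)) * 2 ^ m / fact (m + 1) * of_nat n ^ m) \<and>
         dd.hilbert_series (DD_component X :: nat \<Rightarrow> ('x, 'k::field) dd set) =
           Abs_fps (\<lambda>m. if m = 0 then 0
             else fact (2 * m) * of_nat n ^ m / (fact (m + 1) * fact m)) \<and>
         (\<forall>m\<ge>1. (of_nat (dd.dim (DD_component X m :: ('x, 'k::field) dd set)) :: rat) =
           fact (2 * m) * of_nat n ^ m / (fact (m + 1) * fact m))"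
proof -
  have dim: "(of_nat (dd.dim (DD_component X m :: ('x, 'k) dd set)) :: rat) =
      fact (2 * m) * of_nat n ^ m / (fact (m + 1) * fact m)" if "m \<ge> 1" for m
    using that assms by (simp add: dim_DD_component card_trees catalan_def)
  have odd: "(\<Prod>i=1..m. of_nat (2 * i - 1)) * 2 ^ m / fact (m + 1) * of_nat n ^ m =
      (fact (2 * m) * of_nat n ^ m / (fact (m + 1) * fact m) :: rat)" for m
    by (subst odd_product[symmetric]) simp
  show ?thesis
    unfolding dd.hilbert_series_def odd using dim by (auto simp: fps_eq_iff)
qed

end
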